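(* Let $(X,\rho)$ be a metric space with Borel $\sigma$-algebra $\mathcal{B}$, and let $\dim:\mathcal{B}\to[0,\infty)$ be a dimensional mapping. Then the induced lower measure-dimension mapping $\dim^L$ is upper semi-continuous under the setwise topology on $\mathcal{M}(X)$; that is, if $\nu_n,\nu\in\mathcal{M}(X)$ and $\nu_n\to\nu$ setwise as $n\to\infty$, then $$\limsup_{n\to\infty}\dim^L(\nu_n)\ \leq\ \dim^L(\nu).$$
   Context: $\mathcal{M}(X)$ is the collection of all Borel measures on $(X,\mathcal{B})$ (infinite measures allowed). A dimensional mapping is an arbitrary function $\dim:\mathcal{B}\to[0,\infty)$. The induced lower measure-dimension mapping is $\dim^L(\nu)=\inf\{\dim(A): A\in\mathcal{B},\ \nu(A)>0\}$, with the convention $\inf\emptyset=+\infty$ (relevant only for the zero measure). The setwise topology on $\mathcal{M}(X)$ is the topology generated by the sets $\{\varrho\in\mathcal{M}(X): |\int_X f\,d\varrho-\int_X f\,d\nu|<\epsilon\}$ with $\nu\in\mathcal{M}(X)$, $f:X\to\mathbb{R}$ bounded measurable and $\epsilon>0$. Thus $\nu_n\to\nu$ setwise means $\int f\,d\nu_n\to\int f\,d\nu$ for every bounded measurable $f$; in particular $\nu_n(A)\to\nu(A)$ for every $A\in\mathcal{B}$. *)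

theory Defs
  imports "HOL-Analysis.Analysis"
begin

definition borel_measures :: "'a::topological_space measure set" where
  "borel_measures = {\<nu>. sets \<nu> = sets borel}"

definition dimensional_mapping :: "('a::topological_space set \<Rightarrow> real) \<Rightarrow> bool" where
  "dimensional_mapping d \<longleftrightarrow> (\<forall>A \<in> sets borel. 0 \<le> d A)"

text \<open>In type \<^typ>\<open>ereal\<close> the infimum of the empty set is \<open>\<infinity>\<close>.\<close>

definition lower_measure_dim ::
    "('a::topological_space set \<Rightarrow> real) \<Rightarrow> 'a measure \<Rightarrow> ereal" where
  "lower_measure_dim d \<nu> = (INF A \<in> {A \<in> sets borel. emeasure \<nu> A > 0}. ereal (d A))"

text \<open>
  Measures may be infinite, so a bounded measurable function need not be integrable and the Bochner
  integral (which is \<open>0\<close> for non-integrable functions) is not appropriate. The integral of \<open>f\<close> is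
  that of its positive part minus that of its negative part, in the extended reals; it exists
  unless both are infinite. Note that \<^const>\<open>ennreal\<close> sends negative reals to \<open>0\<close>.
\<close>

definition ext_integral_exists :: "'a measure \<Rightarrow> ('a \<Rightarrow> real) \<Rightarrow> bool" where
  "ext_integral_exists \<nu> f \<longleftrightarrow>
     (\<integral>\<^sup>+x. ennreal (f x) \<partial>\<nu>) < \<infinity> \<or> (\<integral>\<^sup>+x. ennreal (- f x) \<partial>\<nu>) < \<infinity>"

definition ext_integral :: "'a measure \<Rightarrow> ('a \<Rightarrow> real) \<Rightarrow> ereal" where
  "ext_integral \<nu> f =
     enn2ereal (\<integral>\<^sup>+x. ennreal (f x) \<partial>\<nu>) - enn2ereal (\<integral>\<^sup>+x. ennreal (- f x) \<partial>\<nu>)"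

text \<open>
  \<open>ereal_near \<epsilon> a b\<close> says that \<open>b\<close> lies in the \<open>\<epsilon>\<close>-neighbourhood of \<open>a\<close>: for finite \<open>a\<close> this is
  \<open>\<bar>b - a\<bar> < \<epsilon>\<close> (false when \<open>b\<close> is infinite). For infinite \<open>a\<close> the difference is useless, and the
  basic neighbourhoods of \<open>\<plusminus>\<infinity>\<close> in the usual topology of the extended reals are taken instead.
\<close>

definition ereal_near :: "real \<Rightarrow> ereal \<Rightarrow> ereal \<Rightarrow> bool" where
  "ereal_near \<epsilon> a b \<longleftrightarrow>
     (if a = \<infinity> then b > ereal (1 / \<epsilon>)
      else if a = -\<infinity> then b < ereal (- 1 / \<epsilon>)
      else \<bar>b - a\<bar> < ereal \<epsilon>)"

definition setwise_nbhd ::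
    "'a::topological_space measure \<Rightarrow> ('a \<Rightarrow> real) \<Rightarrow> real \<Rightarrow> 'a measure set" where
  "setwise_nbhd \<nu> f \<epsilon> =
     {\<mu> \<in> borel_measures. ext_integral_exists \<mu> f \<and>
        ereal_near \<epsilon> (ext_integral \<nu> f) (ext_integral \<mu> f)}"

definition setwise_topology :: "'a::topological_space measure topology" where
  "setwise_topology = topology_generated_by
     {setwise_nbhd \<nu> f \<epsilon> | \<nu> f \<epsilon>.
        \<nu> \<in> borel_measures \<and> f \<in> borel_measurable borel \<and> bounded (range f) \<and>
        ext_integral_exists \<nu> f \<and> 0 < \<epsilon>}"

definition upper_semicontinuous_map :: "'b topology \<Rightarrow> ('b \<Rightarrow> ereal) \<Rightarrow> bool" where
  "upper_semicontinuous_map T g \<longleftrightarrow> (\<forall>c. openin T {x \<in> topspace T. g x < c})"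

lemma topspace_setwise_topology: "topspace setwise_topology = borel_measures"
proof
  show "topspace setwise_topology \<subseteq> borel_measures"
    unfolding setwise_topology_def topology_generated_by_topspace setwise_nbhd_def by blast
  have "\<nu> \<in> topspace setwise_topology" if "\<nu> \<in> borel_measures" for \<nu> :: "'b::topological_space measure"
  proof -
    have "\<nu> \<in> setwise_nbhd \<nu> (\<lambda>_. 0) 1"
      using that by (simp add: setwise_nbhd_def ext_integral_exists_def ereal_near_def ext_integral_def)
    moreover have "ext_integral_exists \<nu> (\<lambda>_. 0)" by (simp add: ext_integral_exists_def)
    moreover have "(\<lambda>_::'b. 0::real) \<in> borel_measurable borel" "bounded (range (\<lambda>_::'b. 0::real))"
      by auto
    ultimately show ?thesis
      unfolding setwise_topology_def topology_generated_by_topspace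
      using that zero_less_one by blast
  qed
  then show "borel_measures \<subseteq> topspace (setwise_topology :: 'a measure topology)" by blast
qed

lemma ext_integral_indicator:
  assumes "\<nu> \<in> borel_measures" "A \<in> sets borel"
  shows "ext_integral_exists \<nu> (indicator A)" "ext_integral \<nu> (indicator A) = enn2ereal (emeasure \<nu> A)"
proof -
  have 1: "ennreal (indicator A x) = indicator A x" "ennreal (- indicator A x) = 0" for x :: 'a
    by (auto simp: indicator_def ennreal_neg)
  have A: "A \<in> sets \<nu>" using assms by (simp add: borel_measures_def)
  show "ext_integral_exists \<nu> (indicator A)" "ext_integral \<nu> (indicator A) = enn2ereal (emeasure \<nu> A)"
    by (simp_all add: ext_integral_exists_def ext_integral_def 1 A zero_ennreal.rep_eq)
qed

lemma ereal_near_self: "0 < \<epsilon> \<Longrightarrow> ereal_near \<epsilon> a a"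
  by (cases a) (auto simp: ereal_near_def)

lemma open_ereal_near: "open {b. ereal_near \<epsilon> a b}"
proof (cases a)
  case (real r)
  have "{b. ereal_near \<epsilon> a b} = {ereal (r - \<epsilon>)<..<ereal (r + \<epsilon>)}"
  proof (intro set_eqI)
    fix b show "b \<in> {b. ereal_near \<epsilon> a b} \<longleftrightarrow> b \<in> {ereal (r - \<epsilon>)<..<ereal (r + \<epsilon>)}"
      using real by (cases b) (auto simp: ereal_near_def)
  qed
  then show ?thesis by simp
next
  case PInf
  then have "{b. ereal_near \<epsilon> a b} = {ereal (1/\<epsilon>)<..}" by (auto simp: ereal_near_def)
  then show ?thesis by simp
next
  case MInf
  then have "{b. ereal_near \<epsilon> a b} = {..<ereal (- 1/\<epsilon>)}" by (auto simp: ereal_near_def)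
  then show ?thesis by simp
qed

lemma tendsto_ereal_iff_near:
  "(g \<longlongrightarrow> a) F \<longleftrightarrow> (\<forall>\<epsilon>>0. eventually (\<lambda>n. ereal_near \<epsilon> a (g n)) F)"
proof
  assume g: "(g \<longlongrightarrow> a) F"
  show "\<forall>\<epsilon>>0. eventually (\<lambda>n. ereal_near \<epsilon> a (g n)) F"
  proof (intro allI impI)
    fix \<epsilon> :: real assume "0 < \<epsilon>"
    then show "eventually (\<lambda>n. ereal_near \<epsilon> a (g n)) F"
      using topological_tendstoD[OF g open_ereal_near[of \<epsilon> a]] ereal_near_self by simp
  qed
next
  assume R: "\<forall>\<epsilon>>0. eventually (\<lambda>n. ereal_near \<epsilon> a (g n)) F"
  show "(g \<longlongrightarrow> a) F"
  proof (cases a)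
    case (real r)
    show ?thesis
    proof (rule order_tendstoI)
      fix y assume y: "y < a"
      define e where "e = (if y = -\<infinity> then 1 else r - real_of_ereal y)"
      have "0 < e" using y real by (cases y) (auto simp: e_def)
      from R[rule_format, OF this] show "eventually (\<lambda>n. y < g n) F"
      proof eventually_elim
        case (elim n)
        then show ?case using y real by (cases "g n"; cases y) (auto simp: ereal_near_def e_def)
      qed
    next
      fix y assume y: "a < y"
      define e where "e = (if y = \<infinity> then 1 else real_of_ereal y - r)"
      have "0 < e" using y real by (cases y) (auto simp: e_def)
      from R[rule_format, OF this] show "eventually (\<lambda>n. g n < y) F"
      proof eventually_elim
        case (elim n)
        then show ?case using y real by (cases "g n"; cases y) (auto simp: ereal_near_def e_def)
      qed
    qed
  next
    case PInf
    show ?thesis unfolding PInf tendsto_PInfty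
    proof
      fix r :: real
      have "0 < 1 / (\<bar>r\<bar> + 1)" by simp
      from R[rule_format, OF this] show "eventually (\<lambda>n. ereal r < g n) F"
      proof eventually_elim
        case (elim n)
        then show ?case using PInf by (cases "g n") (auto simp: ereal_near_def)
      qed
    qed
  next
    case MInf
    show ?thesis unfolding MInf tendsto_MInfty
    proof
      fix r :: real
      have "0 < 1 / (\<bar>r\<bar> + 1)" by simp
      from R[rule_format, OF this] show "eventually (\<lambda>n. g n < ereal r) F"
      proof eventually_elim
        case (elim n)
        then show ?case using MInf by (cases "g n") (auto simp: ereal_near_def)
      qed
    qed
  qed
qed

text \<open>Convergence in the setwise topology is convergence of the integrals of all bounded measurable
  functions (whenever they make sense for the limit measure), in the extended reals.\<close>

lemma limitin_setwise_topology_iff: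
  fixes N :: "'i \<Rightarrow> 'a::topological_space measure"
  assumes N: "\<And>n. N n \<in> borel_measures" and \<nu>: "\<nu> \<in> borel_measures"
  shows "limitin setwise_topology N \<nu> F \<longleftrightarrow>
    (\<forall>f \<in> borel_measurable borel. bounded (range f) \<longrightarrow> ext_integral_exists \<nu> f \<longrightarrow>
       eventually (\<lambda>n. ext_integral_exists (N n) f) F \<and>
       ((\<lambda>n. ext_integral (N n) f) \<longlongrightarrow> ext_integral \<nu> f) F)"
  (is "?L \<longleftrightarrow> ?R")
proof
  assume L: ?L
  show ?R
  proof (intro ballI impI)
    fix f :: "'a \<Rightarrow> real"
    assume f: "f \<in> borel_measurable borel" "bounded (range f)" "ext_integral_exists \<nu> f"
    have ev: "eventually (\<lambda>n. N n \<in> setwise_nbhd \<nu> f \<epsilon>) F" if "0 < \<epsilon>" for \<epsilon>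
    proof -
      have "openin setwise_topology (setwise_nbhd \<nu> f \<epsilon>)"
        unfolding setwise_topology_def using f \<nu> that by (intro topology_generated_by_Basis) blast
      moreover have "\<nu> \<in> setwise_nbhd \<nu> f \<epsilon>"
        using f \<nu> that by (simp add: setwise_nbhd_def ereal_near_self)
      ultimately show ?thesis using L by (auto simp: limitin_def)
    qed
    show "eventually (\<lambda>n. ext_integral_exists (N n) f) F \<and>
       ((\<lambda>n. ext_integral (N n) f) \<longlongrightarrow> ext_integral \<nu> f) F"
      unfolding tendsto_ereal_iff_near
    proof (intro conjI allI impI)
      show "eventually (\<lambda>n. ext_integral_exists (N n) f) F"
        using ev[OF zero_less_one] by (rule eventually_mono) (simp add: setwise_nbhd_def)
      fix \<epsilon> :: real assume "0 < \<epsilon>"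
      from ev[OF this] show "eventually (\<lambda>n. ereal_near \<epsilon> (ext_integral \<nu> f) (ext_integral (N n) f)) F"
        by (rule eventually_mono) (simp add: setwise_nbhd_def)
    qed
  qed
next
  assume R: ?R
  have "eventually (\<lambda>n. N n \<in> U) F"
    if "generate_topology_on
     {setwise_nbhd \<mu> f \<epsilon> | \<mu> f \<epsilon>.
        \<mu> \<in> borel_measures \<and> f \<in> borel_measurable borel \<and> bounded (range f) \<and>
        ext_integral_exists \<mu> f \<and> 0 < \<epsilon>} U" "\<nu> \<in> U" for U
    using that
  proof (induction rule: generate_topology_on.induct)
    case Empty then show ?case by simp
  next
    case (Int a b) then show ?case by (auto intro: eventually_conj)
  next
    case (UN K)
    then obtain k where "k \<in> K" "\<nu> \<in> k" by blast
    with UN show ?case by (blast intro: eventually_mono)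
  next
    case (Basis s)
    then obtain \<mu> f \<epsilon> where s: "s = setwise_nbhd \<mu> f \<epsilon>"
      and f: "f \<in> borel_measurable borel" "bounded (range f)" by blast
    have ex: "ext_integral_exists \<nu> f" and near: "ereal_near \<epsilon> (ext_integral \<mu> f) (ext_integral \<nu> f)"
      using Basis s by (auto simp: setwise_nbhd_def)
    have 1: "eventually (\<lambda>n. ext_integral_exists (N n) f) F"
      and 2: "((\<lambda>n. ext_integral (N n) f) \<longlongrightarrow> ext_integral \<nu> f) F"
      using R f ex by auto
    have "eventually (\<lambda>n. ereal_near \<epsilon> (ext_integral \<mu> f) (ext_integral (N n) f)) F"
      using topological_tendstoD[OF 2 open_ereal_near[of \<epsilon> "ext_integral \<mu> f"]] near by simp
    with 1 show ?case
      by eventually_elim (simp add: s setwise_nbhd_def N)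
  qed
  then show ?L
    using \<nu> by (simp add: limitin_def topspace_setwise_topology)
      (simp add: setwise_topology_def openin_topology_generated_by_iff)
qed

end

theory Submission
  imports Defs
begin

text \<open>
  A measure satisfies \<open>dim\<^sup>L \<nu> < c\<close> exactly when some Borel set \<open>A\<close> with \<open>dim A < c\<close> is charged by
  \<open>\<nu>\<close> (\<open>lower_measure_dim_less_iff\<close>), so the strict sublevel set \<open>{dim\<^sup>L < c}\<close> is the union of the
  sets \<open>{\<nu>. \<nu> A > 0}\<close> over all such \<open>A\<close>. Each of these is open: evaluation on \<open>A\<close> is integration of
  the bounded measurable function \<open>indicator A\<close>, and positivity is an open condition
  (\<open>openin_setwise_charging\<close>). This gives semicontinuity in terms of open sets, and the
  inequality for the limit superior holds for limits of any upper semicontinuous function in any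
  topology (\<open>Limsup_le_of_upper_semicontinuous_map\<close>).
\<close>

lemma lower_measure_dim_less_iff:
  "lower_measure_dim d \<nu> < c \<longleftrightarrow> (\<exists>A \<in> sets borel. emeasure \<nu> A > 0 \<and> ereal (d A) < c)"
  unfolding lower_measure_dim_def by (auto simp: INF_less_iff)

text \<open>
  Around a measure \<open>\<nu>\<close> charging \<open>A\<close>, the basic neighbourhood given by \<open>indicator A\<close> works, with
  radius \<open>\<nu> A\<close> itself: \<open>\<bar>\<mu> A - \<nu> A\<bar> < \<nu> A\<close> already excludes \<open>\<mu> A = 0\<close>. If \<open>\<nu> A = \<infinity>\<close>, any
  radius will do, because a neighbourhood of \<open>\<infinity>\<close> then consists of numbers above a positive bound.
\<close>

lemma openin_setwise_charging:
  fixes A :: "'a::topological_space set"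
  assumes A: "A \<in> sets borel"
  shows "openin setwise_topology {\<nu> \<in> borel_measures. emeasure \<nu> A > 0}"
proof (subst openin_subopen, intro ballI)
  fix \<nu> :: "'a measure"
  assume "\<nu> \<in> {\<nu> \<in> borel_measures. emeasure \<nu> A > 0}"
  then have \<nu>: "\<nu> \<in> borel_measures" and pos: "enn2ereal (emeasure \<nu> A) > 0"
    by (auto simp: less_ennreal.rep_eq zero_ennreal.rep_eq)
  obtain \<epsilon> :: real where "\<epsilon> > 0"
    and far: "\<not> ereal_near \<epsilon> (enn2ereal (emeasure \<nu> A)) 0"
  proof (cases "enn2ereal (emeasure \<nu> A)")
    case (real r)
    with pos show ?thesis by (intro that[of r]) (auto simp: ereal_near_def)
  next
    case PInf
    then show ?thesis by (intro that[of 1]) (auto simp: ereal_near_def)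
  qed (use pos in auto)
  let ?V = "setwise_nbhd \<nu> (indicator A) \<epsilon>"
  have "bounded (range (indicator A :: 'a \<Rightarrow> real))"
    by (rule boundedI[of _ 1]) (auto simp: indicator_def)
  then have "openin setwise_topology ?V"
    unfolding setwise_topology_def
    using \<nu> A \<open>\<epsilon> > 0\<close> ext_integral_indicator(1)[OF \<nu> A] borel_measurable_indicator[OF A]
    by (intro topology_generated_by_Basis) blast
  moreover have "\<nu> \<in> ?V"
    using \<nu> A \<open>\<epsilon> > 0\<close> by (simp add: setwise_nbhd_def ext_integral_indicator ereal_near_self)
  moreover have "?V \<subseteq> {\<nu> \<in> borel_measures. emeasure \<nu> A > 0}"
  proof
    fix \<mu> assume "\<mu> \<in> ?V"
    then have "\<mu> \<in> borel_measures"
      and "ereal_near \<epsilon> (enn2ereal (emeasure \<nu> A)) (enn2ereal (emeasure \<mu> A))"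
      using \<nu> A by (auto simp: setwise_nbhd_def ext_integral_indicator)
    with far show "\<mu> \<in> {\<nu> \<in> borel_measures. emeasure \<nu> A > 0}"
      by (cases "emeasure \<mu> A = 0") (auto simp: zero_ennreal.rep_eq zero_less_iff_neq_zero)
  qed
  ultimately show "\<exists>V. openin setwise_topology V \<and> \<nu> \<in> V \<and>
      V \<subseteq> {\<nu> \<in> borel_measures. emeasure \<nu> A > 0}"
    by blast
qed

lemma upper_semicontinuous_lower_measure_dim:
  "upper_semicontinuous_map setwise_topology (lower_measure_dim d)"
  unfolding upper_semicontinuous_map_def
proof
  fix c
  have "{\<nu> \<in> topspace setwise_topology. lower_measure_dim d \<nu> < c} =
      (\<Union>A \<in> {A \<in> sets borel. ereal (d A) < c}. {\<nu> \<in> borel_measures. emeasure \<nu> A > 0})"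
    by (auto simp: topspace_setwise_topology lower_measure_dim_less_iff)
  then show "openin setwise_topology {\<nu> \<in> topspace setwise_topology. lower_measure_dim d \<nu> < c}"
    by (auto intro!: openin_setwise_charging)
qed

lemma Limsup_le_of_upper_semicontinuous_map:
  assumes "upper_semicontinuous_map T g" and lim: "limitin T N x F"
  shows "Limsup F (\<lambda>n. g (N n)) \<le> g x"
  unfolding Limsup_le_iff
proof (intro allI impI)
  fix c assume "g x < c"
  moreover have "openin T {y \<in> topspace T. g y < c}"
    using assms(1) by (simp add: upper_semicontinuous_map_def)
  ultimately have "eventually (\<lambda>n. N n \<in> {y \<in> topspace T. g y < c}) F"
    using lim unfolding limitin_def by blast
  then show "eventually (\<lambda>n. g (N n) < c) F"
    by (rule eventually_mono) simp
qed

theorem theorem2p9: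
  fixes d :: "'a::metric_space set \<Rightarrow> real"
  assumes "dimensional_mapping d"
  shows "upper_semicontinuous_map setwise_topology (lower_measure_dim d) \<and>
    (\<forall>(N :: nat \<Rightarrow> 'a measure) \<nu>.
       (\<forall>n. N n \<in> borel_measures) \<longrightarrow> \<nu> \<in> borel_measures \<longrightarrow>
       limitin setwise_topology N \<nu> sequentially \<longrightarrow>
       limsup (\<lambda>n. lower_measure_dim d (N n)) \<le> lower_measure_dim d \<nu>)"
  by (blast intro: upper_semicontinuous_lower_measure_dim Limsup_le_of_upper_semicontinuous_map)

end
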